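(* Consider the DC-resistive power flow model $p = H_g\,\varepsilon$ on a base-constrained spanning forest $\mathcal F=\bigcup_{k=1}^K\mathcal T_k$, where $p$ is a random vector of active power injections at the non-substation nodes. Assume that for any two non-substation nodes $c,d$ (including $c=d$) lying in the same tree of $\mathcal F$, $\Sigma_p(c,d)=\mathbb E[p_cp_d]>0$. If $a\neq b$ are nodes of a tree $\mathcal T_k$ and $a$ is a descendant of $b$ within $\mathcal T_k$, then $$\Sigma_\varepsilon(a,a) > \Sigma_\varepsilon(b,b),$$ where $\Sigma_\varepsilon(c,d)=\mathbb E[\varepsilon_c\varepsilon_d]$.
   Context: Forest: $\mathcal F$ is a finite graph that is a disjoint union of $K$ trees $\mathcal T_1,\dots,\mathcal T_K$, with edge set $\mathcal E^{\mathcal F}$; each $\mathcal T_k$ contains exactly one distinguished node (its substation, or slack bus), regarded as the root of $\mathcal T_k$. There are $N$ non-substation nodes. For a node $a$ of $\mathcal T_k$, a node $b$ of $\mathcal T_k$ is a descendant of $a$ if $a$ lies on the unique path in $\mathcal T_k$ from $b$ to the slack bus (so $a$ is a descendant of itself). Reduced weighted Laplacian: each edge $(ab)\in\mathcal E^{\mathcal F}$ carries a conductance $g_{ab}=g_{ba}>0$. $H_g$ is the $N\times N$ matrix indexed by non-substation nodes obtained from the weighted graph Laplacian of $\mathcal F$ (diagonal entry at $a$ equal to $\sum_{c:(ac)\in\mathcal E^{\mathcal F}}g_{ac}$, the sum being over all neighbours including substations; off-diagonal entry $-g_{ab}$ if $(ab)\in\mathcal E^{\mathcal F}$, and $0$ otherwise)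 by deleting the rows and columns of the $K$ substations. It is invertible. DC-resistive model: $p\in\mathbb R^N$ is a random vector (active power injections at non-substation nodes) with finite second moments, and the random vector $\varepsilon\in\mathbb R^N$ of voltage magnitude deviations is determined by $p=H_g\varepsilon$; thus $\Sigma_\varepsilon=H_g^{-1}\Sigma_pH_g^{-1}$, where $\Sigma_y=\mathbb E[yy^T]$ denotes the (non-central) second moment matrix. At every substation node the voltage deviation is fixed to $\varepsilon=0$, so entries of $\Sigma_\varepsilon$ involving a substation are $0$. *)

theory Defs
  imports "HOL-Probability.Probability" "Graph_Theory.Digraph_Component_Vwalk"
begin

text \<open>
  Undirected graphs are symmetric loop-free digraphs (\<open>pair_graph\<close>), so every edge also occurs
  as the directed 2-cycle running along it and back. The library predicates \<open>forest\<close> and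
  \<open>tree\<close> count those as cycles (they are meant for oriented graphs); the cycles of the
  undirected graph are the directed ones of length at least 3.
\<close>

definition undirected_tree :: "'v pair_pre_digraph \<Rightarrow> bool" where
  "undirected_tree T \<longleftrightarrow>
     pair_graph T \<and> Digraph_Component.connected (with_proj T) \<and>
     \<not> (\<exists>c. pre_digraph.cycle (with_proj T) c \<and> 3 \<le> length c)"

text \<open>
  Nodes have type \<open>'n + 's\<close>: \<open>Inl\<close> marks the non-substation nodes and \<open>Inr\<close> the substations,
  so the number of non-substation nodes is \<open>CARD('n)\<close> and the number of trees is \<open>CARD('s)\<close>.
  The trees are labelled by the substation they contain.
\<close>

definition base_constrained_spanning_forest ::
    "('n + 's) pair_pre_digraph \<Rightarrow> ('s \<Rightarrow> ('n + 's) pair_pre_digraph) \<Rightarrow> bool" where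
  "base_constrained_spanning_forest F T \<longleftrightarrow>
     (\<forall>k. undirected_tree (T k)) \<and>
     (\<forall>k l. k \<noteq> l \<longrightarrow> pverts (T k) \<inter> pverts (T l) = {}) \<and>
     pverts F = (\<Union>k. pverts (T k)) \<and>
     parcs F = (\<Union>k. parcs (T k)) \<and>
     pverts F = UNIV \<and>
     (\<forall>k. pverts (T k) \<inter> range Inr = {Inr k})"

text \<open>
  \<open>descendant T r a b\<close>: in the tree \<open>T\<close> with root \<open>r\<close>, the node \<open>a\<close> is a descendant of \<open>b\<close>,
  i.e. \<open>b\<close> lies on the path from \<open>a\<close> to \<open>r\<close>. In a tree that path (a walk without repeated
  vertices) exists and is unique.
\<close>

definition descendant :: "'v pair_pre_digraph \<Rightarrow> 'v \<Rightarrow> 'v \<Rightarrow> 'v \<Rightarrow> bool" where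
  "descendant T r a b \<longleftrightarrow>
     (\<exists>q. vpath q (with_proj T) \<and> hd q = a \<and> last q = r \<and> b \<in> set q)"

definition laplacian ::
    "'v::finite pair_pre_digraph \<Rightarrow> ('v \<Rightarrow> 'v \<Rightarrow> real) \<Rightarrow> real ^ 'v ^ 'v" where
  "laplacian F g =
     (\<chi> a b. if a = b then (\<Sum>c | (a, c) \<in> parcs F. g a c)
             else if (a, b) \<in> parcs F then - g a b else 0)"

definition reduced_laplacian ::
    "('n::finite + 's::finite) pair_pre_digraph \<Rightarrow> ('n + 's \<Rightarrow> 'n + 's \<Rightarrow> real) \<Rightarrow> real ^ 'n ^ 'n" where
  "reduced_laplacian F g = (\<chi> a b. laplacian F g $ Inl a $ Inl b)"

text \<open>Non-central second moments: the mean is not subtracted.\<close>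

definition second_moment :: "'w measure \<Rightarrow> ('w \<Rightarrow> real ^ 'i) \<Rightarrow> real ^ 'i ^ 'i" where
  "second_moment M y = (\<chi> c d. (LINT w|M. y w $ c * y w $ d))"

text \<open>Extends a vector of voltage deviations to all nodes; it is 0 at the substations.\<close>

definition extend_to_substations :: "real ^ 'n::finite \<Rightarrow> real ^ ('n + 's::finite)" where
  "extend_to_substations x = (\<chi> v. case v of Inl c \<Rightarrow> x $ c | Inr k \<Rightarrow> 0)"

end

theory Submission
  imports Defs
begin

text \<open>
  Removing the first arc \<open>(x, y)\<close> of the path from \<open>x\<close> to the substation cuts off the subtree
  \<open>D\<close> of descendants of \<open>x\<close>. Summing the equations \<open>p = H\<^sub>g \<epsilon>\<close> over \<open>D\<close>, everything inside \<open>D\<close>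
  cancels and \<open>g\<^sub>x\<^sub>y (\<epsilon>\<^sub>x - \<epsilon>\<^sub>y) = (\<Sum>d\<in>D. p\<^sub>d)\<close> remains. Hence, along the path to the substation,
  every \<open>\<epsilon>\<^sub>x\<close> is a combination of injections in its tree with nonnegative weights that grow with
  the distance from the substation. As the second moments of these injections are positive,
  larger weights give a larger second moment of the combination.
\<close>

section \<open>Cutting a tree at an arc\<close>

text \<open>A path from \<open>x\<close> to \<open>y\<close> that uses neither direction of the arc
  closes up with \<open>(y, x)\<close> to a cycle of the kind excluded in an undirected
  tree.\<close>

lemma undirected_tree_arc_bridge:
  assumes tree: "undirected_tree T" and xy: "(x, y) \<in> parcs T"
  shows "(x, y) \<notin> (parcs T - {(x, y), (y, x)})\<^sup>*"
proof
  assume reach: "(x, y) \<in> (parcs T - {(x, y), (y, x)})\<^sup>*"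
  interpret pair_graph T
    using tree by (simp add: undirected_tree_def)
  define H where "H = T\<lparr>parcs := parcs T - {(x, y), (y, x)}\<rparr>"
  have H [simp]: "pverts H = pverts T" "parcs H = parcs T - {(x, y), (y, x)}"
    by (simp_all add: H_def)
  interpret H: pair_wf_digraph H
    by unfold_locales (auto dest: wellformed')
  have neq: "x \<noteq> y"
    using xy pair_no_loops by force
  have yx: "(y, x) \<in> parcs T"
    using xy arcs_ends_symmetric[OF pair_sym_arcs] by simp
  have "x \<rightarrow>\<^sup>*\<^bsub>with_proj H\<^esub> y"
    using reach xy by (subst H.reachable_conv') (auto dest: wellformed')
  then obtain p where p: "H.apath x p y"
    using H.reachable_apath by blast
  then have awalk: "awalk x p y" and dist: "distinct (pawalk_verts x p)"
    and p_sub: "set p \<subseteq> parcs H" and cas: "pcas x p y"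
    by (auto simp: H.apath_def H.awalk_def awalk_def)
  have "awalk y ((y, x) # p) y"
    using awalk yx by (auto simp: awalk_Cons_iff)
  then have "cycle ((y, x) # p)"
    using dist by (auto simp: cycle_def intro!: exI[of _ y])
  \<comment> \<open>\<open>p\<close> is nonempty because \<open>x\<close> and \<open>y\<close>
    differ, and it is not the single arc \<open>(x, y)\<close>, which \<open>H\<close> lacks. So
    \<open>p\<close> has at least two arcs.\<close>
  moreover have "3 \<le> length ((y, x) # p)"
    using p_sub cas neq by (cases p rule: vwalk_arcs.cases) (auto simp: prod_eq_iff)
  ultimately show False
    using tree by (auto simp: undirected_tree_def)
qed

text \<open>\<open>D\<close> is what \<open>x\<close> still reaches once the first arc of the path
  is deleted in both directions. The rest of the path still links \<open>y\<close> to
  \<open>r\<close>, so \<open>r\<close> in \<open>D\<close> would make \<open>y\<close> reachable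
  from \<open>x\<close>, although the deleted arc is a bridge.\<close>

lemma undirected_tree_subtree:
  assumes tree: "undirected_tree T"
    and path: "vpath (x # y # q) (with_proj T)" and r: "last (y # q) = r"
  obtains D where "D \<subseteq> pverts T" "x \<in> D" "r \<notin> D"
    "parcs T \<inter> (D \<times> - D) = {(x, y)}"
proof -
  interpret pair_graph T
    using tree by (simp add: undirected_tree_def)
  define R where "R = parcs T - {(x, y), (y, x)}"
  have symT: "(v, u) \<in> parcs T" if "(u, v) \<in> parcs T" for u v
    using that arcs_ends_symmetric[OF pair_sym_arcs] by simp
  have "sym (R\<^sup>*)"
    by (rule sym_rtrancl) (auto simp: R_def intro!: symI dest: symT)
  have xy: "(x, y) \<in> parcs T" and x: "x \<in> pverts T"
    and tl_arcs: "set (vwalk_arcs (y # q)) \<subseteq> parcs T"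
    and notin: "x \<notin> set (y # q)"
    using path by (auto simp: vpath_def vwalk_def)
  have nxy: "(x, y) \<notin> R\<^sup>*"
    unfolding R_def by (rule undirected_tree_arc_bridge[OF tree xy])
  \<comment> \<open>Both deleted arcs are incident to \<open>x\<close>, so a walk that avoids
    \<open>x\<close> survives the deletion.\<close>
  have "(hd w, last w) \<in> R\<^sup>*"
    if "set (vwalk_arcs w) \<subseteq> parcs T" "x \<notin> set w" "w \<noteq> []" for w
    using that
  proof (induction w rule: vwalk_arcs.induct)
    case (3 u v w)
    then have "(u, v) \<in> R" "(v, last (v # w)) \<in> R\<^sup>*"
      by (auto simp: R_def)
    then show ?case
      by (simp add: converse_rtrancl_into_rtrancl)
  qed auto
  from this[of "y # q"] have "(y, r) \<in> R\<^sup>*"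
    using tl_arcs notin r by simp
  then have nxr: "(x, r) \<notin> R\<^sup>*"
    using nxy \<open>sym (R\<^sup>*)\<close> by (meson rtrancl_trans symD)
  define D where "D = {v. (x, v) \<in> R\<^sup>*}"
  have "v \<in> pverts T" if "(x, v) \<in> R\<^sup>*" for v
    using that x by induction (auto simp: R_def dest: wellformed')
  then have "D \<subseteq> pverts T"
    by (auto simp: D_def)
  moreover have "x \<in> D" "y \<notin> D" "r \<notin> D"
    using nxy nxr by (simp_all add: D_def)
  moreover have "parcs T \<inter> (D \<times> - D) \<subseteq> {(x, y)}"
  proof clarify
    fix u v assume uv: "(u, v) \<in> parcs T" "u \<in> D" "v \<notin> D"
    \<comment> \<open>Only a deleted arc can leave \<open>D\<close>, and \<open>(y, x)\<close> does
      not, since it ends in \<open>D\<close>.\<close>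
    then have "(u, v) \<notin> R"
      using rtrancl_into_rtrancl[of x u R v] by (auto simp: D_def)
    then show "u = x \<and> v = y"
      using uv \<open>x \<in> D\<close> by (auto simp: R_def)
  qed
  ultimately show thesis
    using xy by (intro that[of D]) auto
qed

section \<open>The Laplacian and currents across a cut\<close>

text \<open>Swapping the endpoints permutes the arcs inside \<open>D\<close> and negates
  \<open>f\<close>, so these arcs contribute 0.\<close>

lemma sum_antisymmetric_boundary:
  fixes f :: "'a \<times> 'a \<Rightarrow> real"
  assumes "finite A" "sym A"
    and anti: "\<And>u v. (u, v) \<in> A \<Longrightarrow> f (v, u) = - f (u, v)"
  shows "sum f (A \<inter> (D \<times> UNIV)) = sum f (A \<inter> (D \<times> - D))"
proof -
  have "sum f (A \<inter> (D \<times> D)) = sum (f \<circ> prod.swap) (A \<inter> (D \<times> D))"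
    using \<open>sym A\<close> by (intro sum.reindex_bij_witness[of _ prod.swap prod.swap]) (auto dest: symD)
  also have "\<dots> = - sum f (A \<inter> (D \<times> D))"
    unfolding sum_negf[symmetric] by (rule sum.cong) (auto simp: anti)
  finally have "sum f (A \<inter> (D \<times> D)) = 0"
    by simp
  moreover have "A \<inter> (D \<times> UNIV) = A \<inter> (D \<times> D) \<union> A \<inter> (D \<times> - D)"
    by auto
  moreover have "sum f (A \<inter> (D \<times> D) \<union> A \<inter> (D \<times> - D))
      = sum f (A \<inter> (D \<times> D)) + sum f (A \<inter> (D \<times> - D))"
    using \<open>finite A\<close> by (intro sum.union_disjoint) auto
  ultimately show ?thesis
    by simp
qed

lemma extend_to_substations_nth [simp]:
  "extend_to_substations e $ Inl c = e $ c"
  "extend_to_substations e $ Inr l = 0"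
  by (simp_all add: extend_to_substations_def)

text \<open>The deleted substation columns may be put back because the extended voltage vanishes
  there. Distributing the diagonal entry over the neighbours then gives a sum of edge
  currents.\<close>

lemma reduced_laplacian_mult_nth:
  fixes F :: "('n::finite + 's::finite) pair_pre_digraph"
  assumes "\<And>v. (v, v) \<notin> parcs F"
  defines "E \<equiv> (extend_to_substations :: real ^ 'n \<Rightarrow> real ^ ('n + 's))"
  shows "(reduced_laplacian F g *v e) $ c
    = (\<Sum>v | (Inl c, v) \<in> parcs F. g (Inl c) v * (E e $ Inl c - E e $ v))"
proof -
  let ?L = "\<lambda>v. laplacian F g $ Inl c $ v"
  have "(reduced_laplacian F g *v e) $ c = (\<Sum>j\<in>UNIV. ?L (Inl j) * E e $ Inl j)"
    by (simp add: reduced_laplacian_def matrix_vector_mult_def E_def)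
  also have "\<dots> = (\<Sum>v\<in>UNIV. ?L v * E e $ v)"
    by (simp add: UNIV_Plus_UNIV[symmetric] sum.Plus E_def del: UNIV_Plus_UNIV)
  also have "\<dots> = ?L (Inl c) * E e $ Inl c + (\<Sum>v\<in>UNIV - {Inl c}. ?L v * E e $ v)"
    by (rule sum.remove) auto
  also have "(\<Sum>v\<in>UNIV - {Inl c}. ?L v * E e $ v)
      = (\<Sum>v | (Inl c, v) \<in> parcs F. - g (Inl c) v * E e $ v)"
    using assms(1) by (intro sum.mono_neutral_cong_right) (auto simp: laplacian_def)
  also have "?L (Inl c) * E e $ Inl c
      = (\<Sum>v | (Inl c, v) \<in> parcs F. g (Inl c) v * E e $ Inl c)"
    by (simp add: laplacian_def sum_distrib_right)
  finally show ?thesis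
    by (simp add: sum.distrib[symmetric] right_diff_distrib)
qed

text \<open>Edge currents are antisymmetric, so only the current over the cut arc survives. As
  \<open>D\<close> contains no substation, each of its nodes has a row in the reduced
  matrix.\<close>

lemma reduced_laplacian_sum_cut:
  fixes F :: "('n::finite + 's::finite) pair_pre_digraph"
  assumes loopfree: "\<And>v. (v, v) \<notin> parcs F" and sym: "sym (parcs F)"
    and g_sym: "\<And>u v. (u, v) \<in> parcs F \<Longrightarrow> g u v = g v u"
    and D: "D \<subseteq> range Inl" and cut: "parcs F \<inter> (D \<times> - D) = {(x, y)}"
  defines "E \<equiv> (extend_to_substations :: real ^ 'n \<Rightarrow> real ^ ('n + 's))"
  shows "(\<Sum>c | Inl c \<in> D. (reduced_laplacian F g *v e) $ c) = g x y * (E e $ x - E e $ y)"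
proof -
  let ?f = "\<lambda>(u, v). g u v * (E e $ u - E e $ v)"
  have "(\<Sum>c | Inl c \<in> D. (reduced_laplacian F g *v e) $ c)
      = (\<Sum>c | Inl c \<in> D. \<Sum>v | (Inl c, v) \<in> parcs F. ?f (Inl c, v))"
    by (simp add: reduced_laplacian_mult_nth[OF loopfree] E_def)
  also have "\<dots> = (\<Sum>u\<in>D. \<Sum>v | (u, v) \<in> parcs F. ?f (u, v))"
    using D by (intro sum.reindex_cong[of Inl, symmetric]) auto
  also have "\<dots> = (\<Sum>z\<in>Sigma D (\<lambda>u. {v. (u, v) \<in> parcs F}). ?f z)"
    by (subst sum.Sigma) auto
  also have "Sigma D (\<lambda>u. {v. (u, v) \<in> parcs F}) = parcs F \<inter> (D \<times> UNIV)"
    by auto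
  also have "sum ?f \<dots> = sum ?f (parcs F \<inter> (D \<times> - D))"
  proof (rule sum_antisymmetric_boundary)
    show "?f (v, u) = - ?f (u, v)" if "(u, v) \<in> parcs F" for u v
      using g_sym[OF that] by (simp add: algebra_simps)
  qed (use sym in auto)
  finally show ?thesis
    by (simp add: cut)
qed

section \<open>Voltages as nonnegative combinations of injections\<close>

text \<open>The trees are vertex-disjoint, so an arc of \<open>F\<close> that starts in
  \<open>T k\<close> belongs to \<open>T k\<close>. This carries a cut found in one tree over to the
  forest.\<close>

lemma base_constrained_spanning_forest_arcs:
  assumes forest: "base_constrained_spanning_forest F T"
  shows "(v, v) \<notin> parcs F" and "sym (parcs F)"
    and "D \<subseteq> pverts (T k) \<Longrightarrow> parcs F \<inter> (D \<times> - D) = parcs (T k) \<inter> (D \<times> - D)"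
proof -
  have graph: "pair_graph (T l)" for l
    using forest by (simp add: base_constrained_spanning_forest_def undirected_tree_def)
  have F: "parcs F = (\<Union>l. parcs (T l))"
    using forest by (simp add: base_constrained_spanning_forest_def)
  have "(v, v) \<notin> parcs (T l)" for l
  proof -
    interpret pair_graph "T l" by (rule graph)
    show ?thesis using pair_no_loops by force
  qed
  then show "(v, v) \<notin> parcs F"
    by (simp add: F)
  have "sym (parcs (T l))" for l
  proof -
    interpret pair_graph "T l" by (rule graph)
    show ?thesis using pair_sym_arcs by (simp add: symmetric_def)
  qed
  then show "sym (parcs F)"
    unfolding F by (auto simp: sym_def)
  have "(u, v) \<in> parcs (T k)"
    if uv: "(u, v) \<in> parcs F" "u \<in> pverts (T k)" for u v
  proof -
    obtain l where l: "(u, v) \<in> parcs (T l)"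
      using uv F by auto
    interpret pair_graph "T l" by (rule graph)
    have "u \<in> pverts (T l)"
      using l by (rule in_arcsD1)
    then have "l = k"
      using uv forest by (auto simp: base_constrained_spanning_forest_def)
    then show ?thesis
      using l by simp
  qed
  then show "parcs F \<inter> (D \<times> - D) = parcs (T k) \<inter> (D \<times> - D)" if "D \<subseteq> pverts (T k)"
    using that F by auto
qed

text \<open>\<open>wa\<close> and \<open>wb\<close> are the rows of \<open>H\<^sub>g\<^sup>-\<^sup>1\<close> that belong to \<open>a\<close> and \<open>b\<close>.\<close>

lemma descendant_voltage_weights:
  fixes F :: "('n::finite + 's::finite) pair_pre_digraph"
  assumes forest: "base_constrained_spanning_forest F T"
    and g_sym: "\<And>u v. (u, v) \<in> parcs F \<Longrightarrow> g u v = g v u"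
    and g_pos: "\<And>u v. (u, v) \<in> parcs F \<Longrightarrow> g u v > 0"
    and desc: "descendant (T k) (Inr k) a b" and "a \<noteq> b"
  defines "E \<equiv> (extend_to_substations :: real ^ 'n \<Rightarrow> real ^ ('n + 's))"
  obtains wb wa :: "'n \<Rightarrow> real" where
    "\<forall>c. 0 \<le> wb c" "\<forall>c. wb c \<le> wa c" "\<exists>c. wb c < wa c"
    "\<forall>c. Inl c \<notin> pverts (T k) \<longrightarrow> wa c = 0"
    "\<forall>e. E e $ a = (\<Sum>c\<in>UNIV. wa c * (reduced_laplacian F g *v e) $ c)"
    "\<forall>e. E e $ b = (\<Sum>c\<in>UNIV. wb c * (reduced_laplacian F g *v e) $ c)"
proof -
  \<comment> \<open>The identity is required for every \<open>e\<close>, so the weights are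
    deterministic and no inverse matrix has to be formed.\<close>
  define rep where "rep v w \<longleftrightarrow>
    (\<forall>c. 0 \<le> w c) \<and> (\<forall>c. Inl c \<notin> pverts (T k) \<longrightarrow> w c = 0) \<and>
    (\<forall>e. E e $ v = (\<Sum>c\<in>UNIV. w c * (reduced_laplacian F g *v e) $ c))"
    for v :: "'n + 's" and w :: "'n \<Rightarrow> real"
  have tree: "undirected_tree (T k)" and only_root: "pverts (T k) \<inter> range Inr = {Inr k}"
    using forest by (auto simp: base_constrained_spanning_forest_def)
  note arcs = base_constrained_spanning_forest_arcs[OF forest]
  \<comment> \<open>The node \<open>b\<close> may lie anywhere on the path, so the weights at the
    head are compared with those at every later node.\<close>
  have "\<exists>wa. rep (hd q) wa \<and>
      (\<forall>v\<in>set q - {hd q}. \<exists>w. rep v w \<and> (\<forall>c. w c \<le> wa c) \<and> (\<exists>c. w c < wa c))"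
    if "vpath q (with_proj (T k))" "last q = Inr k" for q
    using that
  proof (induction q rule: vwalk_arcs.induct)
    case 1
    then show ?case
      by (simp add: vpath_def vwalk_def)
  next
    case (2 u)
    then show ?case
      \<comment> \<open>The path consists of the substation alone; its voltage 0 is represented by
        zero weights.\<close>
      by (auto simp: rep_def E_def intro!: exI[of _ "\<lambda>_. 0"])
  next
    case (3 x y q)
    have "vpath (y # q) (with_proj (T k))" "last (y # q) = Inr k"
      using 3(2,3) by (auto simp: vpath_def vwalk_def)
    then obtain wy where wy: "rep y wy"
      \<comment> \<open>The weak inequality is enough here, since the step from \<open>y\<close> to
        \<open>x\<close> supplies strictness anew.\<close>
      and IH: "\<forall>v\<in>set (y # q) - {y}. \<exists>w. rep v w \<and> (\<forall>c. w c \<le> wy c)"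
      using 3(1) unfolding list.sel by blast
    obtain D where D: "D \<subseteq> pverts (T k)" "x \<in> D" "Inr k \<notin> D"
      and cut: "parcs (T k) \<inter> (D \<times> - D) = {(x, y)}"
      using undirected_tree_subtree[OF tree 3(2)] 3(3) by auto
    have D_Inl: "D \<subseteq> range Inl"
    proof
      fix v assume "v \<in> D"
      then show "v \<in> range Inl"
        using D only_root by (cases v) auto
    qed
    then obtain cx where cx: "x = Inl cx"
      using \<open>x \<in> D\<close> by auto
    have cutF: "parcs F \<inter> (D \<times> - D) = {(x, y)}"
      using arcs(3)[OF D(1)] cut by simp
    then have "(x, y) \<in> parcs F"
      by auto
    then have pos: "g x y > 0"
      by (rule g_pos)
    \<comment> \<open>The cut identity, solved for the voltage at \<open>x\<close>, adds the
      injections in \<open>D\<close> divided by \<open>g x y\<close> to the voltage at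
      \<open>y\<close>.\<close>
    define wx where "wx c = wy c + (if Inl c \<in> D then 1 / g x y else 0)" for c
    have le: "wy c \<le> wx c" for c
      using pos by (simp add: wx_def)
    \<comment> \<open>The weight of the injection at \<open>x\<close> itself grows strictly,
      whichever later node is compared.\<close>
    have lt: "wy cx < wx cx"
      using pos D cx by (simp add: wx_def)
    have "E e $ x = (\<Sum>c\<in>UNIV. wx c * (reduced_laplacian F g *v e) $ c)" for e
    proof -
      let ?p = "reduced_laplacian F g *v e"
      have "(\<Sum>c\<in>UNIV. (if Inl c \<in> D then 1 / g x y else 0) * ?p $ c)
          = (\<Sum>c | Inl c \<in> D. ?p $ c) / g x y"
        unfolding sum_divide_distrib by (rule sum.mono_neutral_cong_right) auto
      also have "\<dots> = E e $ x - E e $ y"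
        using reduced_laplacian_sum_cut[OF arcs(1,2) g_sym D_Inl cutF, where e = e] pos
        by (simp add: E_def)
      finally show ?thesis
        using wy by (simp add: rep_def wx_def distrib_right sum.distrib)
    qed
    moreover have "0 \<le> wx c" for c
      using wy le[of c] order_trans unfolding rep_def by blast
    moreover have "wx c = 0" if "Inl c \<notin> pverts (T k)" for c
      using that wy D(1) by (auto simp: rep_def wx_def)
    ultimately have "rep x wx"
      unfolding rep_def by blast
    moreover have "\<exists>w. rep v w \<and> (\<forall>c. w c \<le> wx c) \<and> (\<exists>c. w c < wx c)"
      if v: "v \<in> set (y # q)" for v
    proof -
      obtain w where w: "rep v w" "\<forall>c. w c \<le> wy c"
      proof (cases "v = y")
        case True
        then show thesis
          using wy that[of wy] by simp
      next
        case False
        then show thesis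
          using v IH that by blast
      qed
      then have "\<forall>c. w c \<le> wx c" "w cx < wx cx"
        using le order_trans order_le_less_trans[OF _ lt] by blast+
      then show ?thesis
        using w by blast
    qed
    ultimately show ?case
      unfolding list.sel by - (rule exI[of _ wx], auto)
  qed
  moreover obtain q where "vpath q (with_proj (T k))" "hd q = a" "last q = Inr k" "b \<in> set q - {hd q}"
    using desc \<open>a \<noteq> b\<close> unfolding descendant_def by auto
  ultimately obtain wa wb where "rep a wa" "rep b wb" "\<forall>c. wb c \<le> wa c" "\<exists>c. wb c < wa c"
    by blast
  then show thesis
    unfolding rep_def by (intro that[of wb wa]) blast+
qed

section \<open>Second moments of combinations of injections\<close>

lemma borel_measurable_vec_nth_comp:
  fixes f :: "'w \<Rightarrow> real ^ 'n::finite"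
  assumes "f \<in> borel_measurable M"
  shows "(\<lambda>w. f w $ c) \<in> borel_measurable M"
  by (rule measurable_compose[OF assms borel_measurable_continuous_onI])
    (intro continuous_intros)

text \<open>Expanding the square leaves products of two injections. They are integrable because each
  is dominated by the sum of the two squares.\<close>

lemma integral_square_combination:
  fixes p :: "'w \<Rightarrow> real ^ 'n::finite"
  assumes p_rv: "p \<in> borel_measurable M"
    and p_L2: "\<And>c. integrable M (\<lambda>w. (p w $ c)\<^sup>2)"
  shows "(LINT w|M. (\<Sum>c\<in>UNIV. v c * p w $ c)\<^sup>2)
    = (\<Sum>c\<in>UNIV. \<Sum>d\<in>UNIV. v c * v d * second_moment M p $ c $ d)"
proof -
  have rv: "(\<lambda>w. p w $ c) \<in> borel_measurable M" for c
    using p_rv by (rule borel_measurable_vec_nth_comp)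
  have int: "integrable M (\<lambda>w. p w $ c * p w $ d)" for c d
  proof (rule Bochner_Integration.integrable_bound)
    show "integrable M (\<lambda>w. (p w $ c)\<^sup>2 + (p w $ d)\<^sup>2)"
      using p_L2 by simp
    show "(\<lambda>w. p w $ c * p w $ d) \<in> borel_measurable M"
      using rv by measurable
    have "\<bar>s * t\<bar> \<le> s\<^sup>2 + t\<^sup>2" for s t :: real
    proof -
      have "2 * \<bar>s * t\<bar> \<le> s\<^sup>2 + t\<^sup>2"
        using sum_squares_bound[of "\<bar>s\<bar>" "\<bar>t\<bar>"] by (simp add: abs_mult)
      then show ?thesis
        using abs_ge_zero[of "s * t"] by linarith
    qed
    then show "AE w in M. norm (p w $ c * p w $ d) \<le> norm ((p w $ c)\<^sup>2 + (p w $ d)\<^sup>2)"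
      by simp
  qed
  have "(LINT w|M. (\<Sum>c\<in>UNIV. v c * p w $ c)\<^sup>2)
      = (LINT w|M. (\<Sum>c\<in>UNIV. \<Sum>d\<in>UNIV. (v c * v d) * (p w $ c * p w $ d)))"
    by (simp add: power2_eq_square sum_product mult_ac)
  also have "\<dots> = (\<Sum>c\<in>UNIV. \<Sum>d\<in>UNIV. v c * v d * second_moment M p $ c $ d)"
    using int by (simp add: Bochner_Integration.integral_sum second_moment_def)
  finally show ?thesis .
qed

text \<open>Off \<open>V\<close> both weights vanish, so the sign of \<open>S\<close> matters only
  on \<open>V\<close>. There every term grows weakly, and the diagonal term at \<open>i\<close>
  strictly.\<close>

lemma quadratic_form_strict_mono:
  fixes S :: "'n::finite \<Rightarrow> 'n \<Rightarrow> real"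
  assumes nonneg: "\<And>c. 0 \<le> wb c" and le: "\<And>c. wb c \<le> wa c" and lt: "wb i < wa i"
    and supp: "\<And>c. c \<notin> V \<Longrightarrow> wa c = 0"
    and pos: "\<And>c d. c \<in> V \<Longrightarrow> d \<in> V \<Longrightarrow> 0 < S c d"
  shows "(\<Sum>c\<in>UNIV. \<Sum>d\<in>UNIV. wb c * wb d * S c d) < (\<Sum>c\<in>UNIV. \<Sum>d\<in>UNIV. wa c * wa d * S c d)"
proof -
  have supp': "wb c = 0" if "c \<notin> V" for c
    using that nonneg[of c] le[of c] supp[of c] by simp
  have i: "i \<in> V"
    using lt supp supp' by force
  have term_le: "wb c * wb d * S c d \<le> wa c * wa d * S c d" for c d
  proof (cases "c \<in> V \<and> d \<in> V")
    case True
    have "wb c * wb d \<le> wa c * wa d"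
      using nonneg le by (meson mult_mono order_trans)
    then show ?thesis
      using True pos by (simp add: mult_right_mono)
  qed (auto simp: supp supp')
  have "wb i * wb i < wa i * wa i"
    using lt nonneg by (intro mult_strict_mono') auto
  then have "wb i * wb i * S i i < wa i * wa i * S i i"
    using pos[OF i i] by simp
  then have "(\<Sum>d\<in>UNIV. wb i * wb d * S i d) < (\<Sum>d\<in>UNIV. wa i * wa d * S i d)"
    using term_le by (intro sum_strict_mono_ex1) auto
  then show ?thesis
    using term_le by (intro sum_strict_mono_ex1) (auto intro: sum_mono)
qed

theorem theorem1:
  fixes F :: "('n::finite + 's::finite) pair_pre_digraph"
    and T :: "'s \<Rightarrow> ('n + 's) pair_pre_digraph"
    and g :: "'n + 's \<Rightarrow> 'n + 's \<Rightarrow> real"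
    and M :: "'w measure"
    and p eps :: "'w \<Rightarrow> real ^ 'n"
    and k :: 's and a b :: "'n + 's"
  assumes forest: "base_constrained_spanning_forest F T"
    and g_sym: "\<And>u v. (u, v) \<in> parcs F \<Longrightarrow> g u v = g v u"
    and g_pos: "\<And>u v. (u, v) \<in> parcs F \<Longrightarrow> g u v > 0"
    and M: "prob_space M"
    and p_rv: "p \<in> borel_measurable M"
    and p_L2: "\<And>c. integrable M (\<lambda>w. (p w $ c)\<^sup>2)"
    and eps_rv: "eps \<in> borel_measurable M"
    and model: "AE w in M. p w = reduced_laplacian F g *v eps w"
    and pos: "\<And>l c d. \<lbrakk>Inl c \<in> pverts (T l); Inl d \<in> pverts (T l)\<rbrakk>
                \<Longrightarrow> second_moment M p $ c $ d > 0"
    and ab: "a \<in> pverts (T k)" "b \<in> pverts (T k)" "a \<noteq> b"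
    and desc: "descendant (T k) (Inr k) a b"
  shows "second_moment M (\<lambda>w. extend_to_substations (eps w)) $ a $ a
       > second_moment M (\<lambda>w. extend_to_substations (eps w)) $ b $ b"
proof -
  define E where "E = (extend_to_substations :: real ^ 'n \<Rightarrow> real ^ ('n + 's))"
  obtain wb wa :: "'n \<Rightarrow> real" where
    w: "\<forall>c. 0 \<le> wb c" "\<forall>c. wb c \<le> wa c" and lt: "\<exists>c. wb c < wa c"
    and supp: "\<forall>c. Inl c \<notin> pverts (T k) \<longrightarrow> wa c = 0"
    and wa: "\<forall>e. E e $ a = (\<Sum>c\<in>UNIV. wa c * (reduced_laplacian F g *v e) $ c)"
    and wb: "\<forall>e. E e $ b = (\<Sum>c\<in>UNIV. wb c * (reduced_laplacian F g *v e) $ c)"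
    using forest g_sym g_pos desc ab(3) unfolding E_def
    by (rule descendant_voltage_weights[where g = g]) blast+
  have moment: "second_moment M (\<lambda>w. E (eps w)) $ v $ v
      = (\<Sum>c\<in>UNIV. \<Sum>d\<in>UNIV. u c * u d * second_moment M p $ c $ d)"
    if u: "\<forall>e. E e $ v = (\<Sum>c\<in>UNIV. u c * (reduced_laplacian F g *v e) $ c)" for v u
  proof -
    have meas_E: "(\<lambda>w. E (eps w) $ v) \<in> borel_measurable M"
    proof (cases v)
      case (Inl c)
      show ?thesis
        using borel_measurable_vec_nth_comp[OF eps_rv, of c] by (simp add: Inl E_def)
    qed (simp add: E_def)
    have meas_p: "(\<lambda>w. \<Sum>c\<in>UNIV. u c * p w $ c) \<in> borel_measurable M"
      by (intro borel_measurable_sum borel_measurable_times borel_measurable_const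
          borel_measurable_vec_nth_comp[OF p_rv])
    have "second_moment M (\<lambda>w. E (eps w)) $ v $ v = (LINT w|M. (E (eps w) $ v)\<^sup>2)"
      by (simp add: second_moment_def power2_eq_square)
    also have "\<dots> = (LINT w|M. (\<Sum>c\<in>UNIV. u c * p w $ c)\<^sup>2)"
    \<comment> \<open>The model equation holds only almost everywhere, so the integrands are
      compared up to a null set, which calls for their measurability.\<close>
    proof (rule integral_cong_AE)
      show "AE w in M. (E (eps w) $ v)\<^sup>2 = (\<Sum>c\<in>UNIV. u c * p w $ c)\<^sup>2"
        using model by eventually_elim (use u in simp)
    qed (use meas_E meas_p in measurable)
    also have "\<dots> = (\<Sum>c\<in>UNIV. \<Sum>d\<in>UNIV. u c * u d * second_moment M p $ c $ d)"
      by (rule integral_square_combination[OF p_rv p_L2])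
    finally show ?thesis .
  qed
  obtain i where "wb i < wa i"
    using lt by blast
  then have "(\<Sum>c\<in>UNIV. \<Sum>d\<in>UNIV. wb c * wb d * second_moment M p $ c $ d)
      < (\<Sum>c\<in>UNIV. \<Sum>d\<in>UNIV. wa c * wa d * second_moment M p $ c $ d)"
    using w supp pos[of _ k]
    by (intro quadratic_form_strict_mono[where V = "{c. Inl c \<in> pverts (T k)}"]) auto
  then show ?thesis
    using moment[OF wa] moment[OF wb] by (simp add: E_def)
qed

end
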